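(* Let $\sigma:\mathbb{Z}^n\times\mathbb{T}^n\to\mathbb{C}$ be a measurable function such that there exist a positive function $\lambda:\mathbb{Z}^n\to\mathbb{R}$ and a function $\omega\in\ell^1(\mathbb{Z}^n)$ with $$|(\mathcal{F}_{\mathbb{T}^n}\sigma)(k,m)|\le\lambda(k)|\omega(m)|\quad\text{for all }m,k\in\mathbb{Z}^n,$$ and such that $\lim_{|k|\to\infty}\lambda(k)=0$. Then the pseudo-difference operator $\mathrm{Op}(\sigma):\ell^p(\mathbb{Z}^n)\to\ell^p(\mathbb{Z}^n)$ is a compact operator for all $1\le p<\infty$.
   Context: $\mathbb{T}^n=\mathbb{R}^n/\mathbb{Z}^n$ with normalised Lebesgue measure. For $f\in\ell^1(\mathbb{Z}^n)$, $\widehat f(x)=\sum_{k\in\mathbb{Z}^n}e^{-2\pi i k\cdot x}f(k)$ and $\mathrm{Op}(\sigma)f(k)=\int_{\mathbb{T}^n}e^{2\pi i k\cdot x}\sigma(k,x)\widehat f(x)\,dx$; on $\ell^p(\mathbb{Z}^n)$ the operator is understood as the extension by density from $\ell^1(\mathbb{Z}^n)$. The Fourier transform of $\sigma$ in the second variable is $(\mathcal{F}_{\mathbb{T}^n}\sigma)(k,m)=\int_{\mathbb{T}^n}e^{-2\pi i m\cdot x}\sigma(k,x)\,dx$ (with $\sigma(k,\cdot)$ integrable for each $k$). *)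

theory Defs
  imports "HOL-Analysis.Analysis"
begin

definition ell :: "real \<Rightarrow> ('a \<Rightarrow> complex) set" where
  "ell p = {f. (\<lambda>k. norm (f k) powr p) summable_on UNIV}"

definition ell_norm :: "real \<Rightarrow> ('a \<Rightarrow> complex) \<Rightarrow> real" where
  "ell_norm p f = (\<Sum>\<^sub>\<infinity>k. norm (f k) powr p) powr (1 / p)"

definition ell_dist :: "real \<Rightarrow> ('a \<Rightarrow> complex) \<Rightarrow> ('a \<Rightarrow> complex) \<Rightarrow> real" where
  "ell_dist p f g = ell_norm p (\<lambda>k. f k - g k)"

definition ell_topology :: "real \<Rightarrow> ('a \<Rightarrow> complex) topology" where
  "ell_topology p = Metric_space.mtopology (ell p) (ell_dist p)"

definition linear_on_ell :: "real \<Rightarrow> (('a \<Rightarrow> complex) \<Rightarrow> ('a \<Rightarrow> complex)) \<Rightarrow> bool" where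
  "linear_on_ell p T \<longleftrightarrow>
     T \<in> ell p \<rightarrow> ell p \<and>
     (\<forall>f\<in>ell p. \<forall>g\<in>ell p. T (\<lambda>k. f k + g k) = (\<lambda>k. T f k + T g k)) \<and>
     (\<forall>c. \<forall>f\<in>ell p. T (\<lambda>k. c * f k) = (\<lambda>k. c * T f k))"

definition bounded_operator :: "real \<Rightarrow> (('a \<Rightarrow> complex) \<Rightarrow> ('a \<Rightarrow> complex)) \<Rightarrow> bool" where
  "bounded_operator p T \<longleftrightarrow>
     linear_on_ell p T \<and> (\<exists>C. \<forall>f\<in>ell p. ell_norm p (T f) \<le> C * ell_norm p f)"

definition compact_operator :: "real \<Rightarrow> (('a \<Rightarrow> complex) \<Rightarrow> ('a \<Rightarrow> complex)) \<Rightarrow> bool" where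
  "compact_operator p T \<longleftrightarrow>
     linear_on_ell p T \<and>
     (\<forall>B. Metric_space.mbounded (ell p) (ell_dist p) B \<longrightarrow>
        compactin (ell_topology p) (ell_topology p closure_of (T ` B)))"

text \<open>
  \<open>T\<close> is the continuous linear extension to \<open>\<ell>\<^sup>p\<close> of the map \<open>S\<close> given on \<open>\<ell>\<^sup>1\<close>. Requiring
  \<open>T\<close> to be \<^const>\<open>undefined\<close> outside \<open>\<ell>\<^sup>p\<close> makes \<open>T\<close> unique as a HOL function.
\<close>

definition density_extension ::
  "real \<Rightarrow> (('a \<Rightarrow> complex) \<Rightarrow> ('a \<Rightarrow> complex)) \<Rightarrow> (('a \<Rightarrow> complex) \<Rightarrow> ('a \<Rightarrow> complex)) \<Rightarrow> bool" where
  "density_extension p S T \<longleftrightarrow>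
     T \<in> extensional (ell p) \<and> bounded_operator p T \<and> (\<forall>f\<in>ell 1. T f = S f)"


text \<open>
  Points of \<open>\<int>\<^sup>n\<close> have type \<^typ>\<open>int ^ 'n\<close>. A function on \<open>\<real>\<^sup>n / \<int>\<^sup>n\<close> is a \<open>\<int>\<^sup>n\<close>-periodic function on
  \<open>\<real>\<^sup>n\<close>, and its integral against normalised Lebesgue measure is its Lebesgue integral over the
  fundamental domain \<open>[0,1)\<^sup>n\<close>.
\<close>

definition real_vec :: "int ^ 'n \<Rightarrow> real ^ 'n" where
  "real_vec k = (\<chi> i. real_of_int (k $ i))"

definition torus_function :: "(real ^ 'n \<Rightarrow> complex) \<Rightarrow> bool" where
  "torus_function g \<longleftrightarrow> (\<forall>x m. g (x + real_vec m) = g x)"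

definition torus_measure :: "(real ^ 'n) measure" where
  "torus_measure = lebesgue_on {x. \<forall>i. 0 \<le> x $ i \<and> x $ i < 1}"

definition character :: "int ^ 'n \<Rightarrow> real ^ 'n \<Rightarrow> complex" where
  "character k x = exp (2 * complex_of_real pi * \<i> * complex_of_real (real_vec k \<bullet> x))"

definition fourier_series :: "(int ^ 'n \<Rightarrow> complex) \<Rightarrow> real ^ 'n \<Rightarrow> complex" where
  "fourier_series f x = (\<Sum>\<^sub>\<infinity>k. character (- k) x * f k)"

definition Op ::
  "(int ^ 'n \<Rightarrow> real ^ 'n \<Rightarrow> complex) \<Rightarrow> (int ^ 'n \<Rightarrow> complex) \<Rightarrow> int ^ 'n \<Rightarrow> complex" where
  "Op \<sigma> f k = (\<integral>x. character k x * \<sigma> k x * fourier_series f x \<partial>torus_measure)"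

definition Op_ell ::
  "real \<Rightarrow> (int ^ 'n \<Rightarrow> real ^ 'n \<Rightarrow> complex) \<Rightarrow> (int ^ 'n \<Rightarrow> complex) \<Rightarrow> int ^ 'n \<Rightarrow> complex" where
  "Op_ell p \<sigma> = (THE T. density_extension p (Op \<sigma>) T)"

definition fourier_symbol ::
  "(int ^ 'n \<Rightarrow> real ^ 'n \<Rightarrow> complex) \<Rightarrow> int ^ 'n \<Rightarrow> int ^ 'n \<Rightarrow> complex" where
  "fourier_symbol \<sigma> k m = (\<integral>x. character (- m) x * \<sigma> k x \<partial>torus_measure)"

end

theory Submission
  imports Defs
begin

text \<open>
  On \<open>\<ell>\<^sup>1\<close>, Fubini's theorem gives
  \<open>Op \<sigma> f k = (\<Sum>m. fourier_symbol \<sigma> k (m - k) * f m)\<close>, so \<open>|Op \<sigma> f k|\<close> is at most \<open>lam k\<close> times a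
  convolution of \<open>|\<omega>|\<close> (reflected) with \<open>|f|\<close>. Young's inequality extends this matrix operator to \<open>\<ell>\<^sup>p\<close>,
  and density of the finitely supported functions makes the extension unique. Since \<open>lam\<close> exceeds any
  given \<open>\<epsilon> > 0\<close> only on a finite set, the image of a bounded set is bounded at each point and has
  uniformly small tails; such a set is totally bounded in the complete space \<open>\<ell>\<^sup>p\<close>.
\<close>

section \<open>Convexity of powers and Jensen's inequality for infinite sums\<close>

text \<open>A convex function lies above its tangent at t. Convexity is applied on the open
  half-line, so u = 0 is treated by hand: there the claim becomes (1 - p) * t^p <= 0.\<close>

lemma powr_tangent_le:
  fixes p t u :: real
  assumes "1 \<le> p" "0 < t" "0 \<le> u"
  shows "t powr p + p * t powr (p - 1) * (u - t) \<le> u powr p"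
proof (cases "u = 0")
  case True
  have "t powr (p - 1) * t = t powr p"
    using assms by (simp add: powr_mult_base mult.commute)
  then have "t powr p + p * t powr (p - 1) * (u - t) = (1 - p) * t powr p"
    using True by (simp add: algebra_simps)
  also have "\<dots> \<le> 0"
    using assms by (simp add: mult_nonpos_nonneg)
  finally show ?thesis
    using True by simp
next
  case False
  have "p * t powr (p - 1) * (u - t) \<le> u powr p - t powr p"
  proof (rule convex_on_imp_above_tangent[where A = "{0<..}"])
    show "convex_on {0<..} (\<lambda>x. x powr p)"
      using assms(1) by (rule powr_convex)
    show "((\<lambda>x. x powr p) has_real_derivative p * t powr (p - 1)) (at t within {0<..})"
      by (rule has_field_derivative_at_within[OF has_real_derivative_powr[OF assms(2)]])
  qed (use assms False in \<open>auto simp: interior_open\<close>)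
  then show ?thesis
    by simp
qed

text \<open>Serves to dominate \<open>a j * u j\<close> by the summable
  \<open>a j + a j * u j powr p\<close> in Jensen's inequality.\<close>

lemma le_one_plus_powr:
  fixes p u :: real
  assumes "1 \<le> p" "0 \<le> u"
  shows "u \<le> 1 + u powr p"
proof (cases "u \<le> 1")
  case False
  then have "u powr 1 \<le> u powr p"
    using assms by (intro powr_mono) auto
  then show ?thesis
    using False by simp
qed (simp add: add_increasing2)

text \<open>Summing the tangent inequality against the weights gives a bound for every t > 0; the
  weighted mean t = S / W cancels its linear term. The weights are not normalised, and the factor
  with exponent p - 1 accounts for their total mass.\<close>

lemma jensen_powr_infsum:
  fixes a u :: "'a \<Rightarrow> real"
  assumes p: "1 \<le> p" and a0: "\<And>j. 0 \<le> a j" and u0: "\<And>j. 0 \<le> u j"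
    and a: "a summable_on A" and au: "(\<lambda>j. a j * u j powr p) summable_on A"
  shows "(\<lambda>j. a j * u j) summable_on A"
    and "(\<Sum>\<^sub>\<infinity>j\<in>A. a j * u j) powr p
           \<le> (\<Sum>\<^sub>\<infinity>j\<in>A. a j) powr (p - 1) * (\<Sum>\<^sub>\<infinity>j\<in>A. a j * u j powr p)"
proof -
  show summ: "(\<lambda>j. a j * u j) summable_on A"
  proof (rule summable_on_comparison_test)
    show "(\<lambda>j. a j + a j * u j powr p) summable_on A"
      by (rule summable_on_add[OF a au])
    show "a j * u j \<le> a j + a j * u j powr p" for j
      using mult_left_mono[OF le_one_plus_powr[OF p u0] a0] by (simp add: distrib_left)
  qed (simp add: a0 u0)
  define W S P where "W = (\<Sum>\<^sub>\<infinity>j\<in>A. a j)" and "S = (\<Sum>\<^sub>\<infinity>j\<in>A. a j * u j)"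
    and "P = (\<Sum>\<^sub>\<infinity>j\<in>A. a j * u j powr p)"
  have nonneg: "0 \<le> W" "0 \<le> S" "0 \<le> P"
    unfolding W_def S_def P_def by (auto intro!: infsum_nonneg simp: a0 u0)
  have tangent: "W * t powr p + p * t powr (p - 1) * (S - W * t) \<le> P" if "0 < t" for t
  proof -
    have "((\<lambda>j. a j * t powr p + p * t powr (p - 1) * (a j * u j - a j * t)) has_sum
        (W * t powr p + p * t powr (p - 1) * (S - W * t))) A"
      unfolding W_def S_def diff_conv_add_uminus
      by (intro has_sum_add has_sum_cmult_right has_sum_cmult_left has_sum_uminusI has_sum_infsum a summ)
    moreover have "((\<lambda>j. a j * u j powr p) has_sum P) A"
      unfolding P_def by (rule has_sum_infsum[OF au])
    ultimately show ?thesis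
    proof (rule has_sum_mono)
      fix j
      show "a j * t powr p + p * t powr (p - 1) * (a j * u j - a j * t) \<le> a j * u j powr p"
        using mult_left_mono[OF powr_tangent_le[OF p that u0] a0, of j j]
        by (simp add: algebra_simps)
    qed
  qed
  have "S powr p \<le> W powr (p - 1) * P"
  \<comment> \<open>The tangent point \<open>S / W\<close> has to be positive. This excludes S = 0,
    and W = 0 would force every weight, hence S, to vanish.\<close>
  proof (cases "S = 0")
    case True
    then show ?thesis
      using nonneg by simp
  next
    case False
    have "W \<noteq> 0"
    proof
      assume "W = 0"
      then have "a j = 0" if "j \<in> A" for j
        using nonneg_infsum_le_0D[of a A] a a0 that unfolding W_def by auto
      then have "S = 0"
        unfolding S_def by (auto intro!: infsum_0)
      with False show False by simp
    qed
    then have pos: "0 < W" "0 < S"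
      using nonneg False by auto
    have "W * (S / W) powr p \<le> P"
      using tangent[of "S / W"] pos by simp
    moreover have "W * (S / W) powr p = S powr p / W powr (p - 1)"
      using pos by (simp add: powr_divide powr_diff)
    ultimately show ?thesis
      using pos by (simp add: pos_divide_le_eq mult.commute)
  qed
  then show "S powr p \<le> W powr (p - 1) * P" .
qed

subsection \<open>The metric space \<open>\<ell>\<^sup>p\<close>\<close>

lemma ell_norm_nonneg [simp]: "0 \<le> ell_norm p f"
  by (simp add: ell_norm_def)

lemma ell_norm_powr:
  assumes "1 \<le> p"
  shows "ell_norm p f powr p = (\<Sum>\<^sub>\<infinity>k. norm (f k) powr p)"
  using assms by (simp add: ell_norm_def powr_powr infsum_nonneg)

lemma sum_powr_le_ell_norm:
  assumes "1 \<le> p" "f \<in> ell p" "finite F"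
  shows "(\<Sum>k\<in>F. norm (f k) powr p) \<le> ell_norm p f powr p"
  using assms unfolding ell_norm_powr[OF assms(1)] ell_def
  by (auto intro!: finite_sum_le_infsum)

text \<open>The terms are nonnegative, so a uniform bound on finite partial sums yields summability
  and the norm bound at once. Later estimates in \<open>ell p\<close> thus reduce to finite
  sums.\<close>

lemma ell_boundI:
  assumes p: "1 \<le> p" and C: "0 \<le> C"
    and le: "\<And>F. finite F \<Longrightarrow> (\<Sum>k\<in>F. norm (f k) powr p) \<le> C powr p"
  shows ell_memI: "f \<in> ell p" and ell_norm_leI: "ell_norm p f \<le> C"
proof -
  have "(\<lambda>k. norm (f k) powr p) summable_on UNIV"
    by (rule nonneg_bdd_above_summable_on) (auto intro!: bdd_aboveI[of _ "C powr p"] le)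
  then show "f \<in> ell p"
    by (simp add: ell_def)
  then have "(\<Sum>\<^sub>\<infinity>k. norm (f k) powr p) \<le> C powr p"
    unfolding ell_def by (auto intro!: infsum_le_finite_sums le)
  then have "ell_norm p f \<le> (C powr p) powr (1 / p)"
    unfolding ell_norm_def using p by (auto intro!: powr_mono2 infsum_nonneg)
  then show "ell_norm p f \<le> C"
    using p C by (simp add: powr_powr)
qed

lemma norm_le_ell_norm:
  assumes "1 \<le> p" "f \<in> ell p"
  shows "norm (f k) \<le> ell_norm p f"
proof -
  have "norm (f k) powr p \<le> ell_norm p f powr p"
    using sum_powr_le_ell_norm[OF assms, of "{k}"] by simp
  then show ?thesis
    using assms(1) powr_less_mono2[of p "ell_norm p f" "norm (f k)"] by fastforce
qed

lemma ell_norm_zero [simp]: "ell_norm p (\<lambda>k. 0) = 0"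
  by (simp add: ell_norm_def)

lemma ell_norm_eq_0_iff:
  assumes "1 \<le> p" "f \<in> ell p"
  shows "ell_norm p f = 0 \<longleftrightarrow> f = (\<lambda>k. 0)"
  using norm_le_ell_norm[OF assms] by fastforce

lemma ell_mono:
  assumes p: "1 \<le> p" and g: "g \<in> ell p" and le: "\<And>k. norm (f k) \<le> norm (g k)"
  shows ell_mono_mem: "f \<in> ell p" and ell_norm_mono: "ell_norm p f \<le> ell_norm p g"
proof -
  have "(\<Sum>k\<in>F. norm (f k) powr p) \<le> ell_norm p g powr p" if "finite F" for F
    by (rule order_trans[OF sum_mono sum_powr_le_ell_norm[OF p g that]])
      (use p le in \<open>auto intro!: powr_mono2\<close>)
  then show "f \<in> ell p" "ell_norm p f \<le> ell_norm p g"
    by (rule ell_boundI[OF p ell_norm_nonneg], simp)+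
qed

lemma ell_scale:
  assumes p: "1 \<le> p" and f: "f \<in> ell p"
  shows ell_scale_mem: "(\<lambda>k. c * f k) \<in> ell p"
    and ell_norm_scale_le: "ell_norm p (\<lambda>k. c * f k) \<le> norm c * ell_norm p f"
proof -
  have "(\<Sum>k\<in>F. norm (c * f k) powr p) \<le> (norm c * ell_norm p f) powr p" if "finite F" for F
    using sum_powr_le_ell_norm[OF p f that]
    by (simp add: norm_mult powr_mult mult_left_mono flip: sum_distrib_left)
  then show "(\<lambda>k. c * f k) \<in> ell p" "ell_norm p (\<lambda>k. c * f k) \<le> norm c * ell_norm p f"
    by (rule ell_boundI[OF p mult_nonneg_nonneg[OF norm_ge_zero ell_norm_nonneg]], simp)+
qed

text \<open>Minkowski's inequality is Jensen's inequality for two points weighted by the two norms.\<close>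

lemma ell_add:
  assumes p: "1 \<le> p" and f: "f \<in> ell p" and g: "g \<in> ell p"
  shows ell_add_mem: "(\<lambda>k. f k + g k) \<in> ell p"
    and ell_norm_triangle: "ell_norm p (\<lambda>k. f k + g k) \<le> ell_norm p f + ell_norm p g"
proof -
  define a b where "a = ell_norm p f" and "b = ell_norm p g"
  have ab: "0 \<le> a" "0 \<le> b"
    by (auto simp: a_def b_def)
  \<comment> \<open>Divided by its norm, a nonzero \<open>h\<close> has p-th powers summing to at
    most 1; for norm zero the outer factor kills the left side.\<close>
  have scaled: "ell_norm p h * (\<Sum>k\<in>F. (norm (h k) / ell_norm p h) powr p) \<le> ell_norm p h"
    if "h \<in> ell p" "finite F" for h :: "'a \<Rightarrow> complex" and F
  proof (cases "ell_norm p h = 0")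
    case False
    then have "0 < ell_norm p h"
      using ell_norm_nonneg[of p h] by linarith
    then have "(\<Sum>k\<in>F. (norm (h k) / ell_norm p h) powr p) \<le> 1"
      using sum_powr_le_ell_norm[OF p that]
      by (simp add: powr_divide divide_le_eq flip: sum_divide_distrib)
    then show ?thesis
      by (simp add: mult_left_le)
  qed simp
  have "(\<Sum>k\<in>F. norm (f k + g k) powr p) \<le> (a + b) powr p" if F: "finite F" for F
  proof -
    have "norm (f k + g k) powr p \<le> (a + b) powr (p - 1) *
        (a * (norm (f k) / a) powr p + b * (norm (g k) / b) powr p)" for k
    proof -
      define u where "u = (\<lambda>c. if c then norm (f k) / a else norm (g k) / b)"
      have "(\<Sum>\<^sub>\<infinity>c\<in>UNIV. (if c then a else b) * u c) powr p
          \<le> (\<Sum>\<^sub>\<infinity>c\<in>UNIV. if c then a else b) powr (p - 1) *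
            (\<Sum>\<^sub>\<infinity>c\<in>UNIV. (if c then a else b) * u c powr p)"
        by (rule jensen_powr_infsum(2)[OF p]) (auto simp: ab u_def)
      \<comment> \<open>If a norm is zero, the function itself vanishes, so the convention x / 0 = 0
        still gives the right value.\<close>
      moreover have "a * (norm (f k) / a) = norm (f k)" "b * (norm (g k) / b) = norm (g k)"
        using ell_norm_eq_0_iff[OF p] f g by (auto simp: a_def b_def)
      ultimately have "(norm (f k) + norm (g k)) powr p \<le> (a + b) powr (p - 1) *
        (a * (norm (f k) / a) powr p + b * (norm (g k) / b) powr p)"
        by (simp add: UNIV_bool u_def add.commute del: times_divide_eq_right)
      then show ?thesis
        using p norm_triangle_ineq[of "f k" "g k"]
        by (meson norm_ge_zero order_trans powr_mono2 zero_le_one)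
    qed
    then have "(\<Sum>k\<in>F. norm (f k + g k) powr p) \<le> (\<Sum>k\<in>F. (a + b) powr (p - 1) *
        (a * (norm (f k) / a) powr p + b * (norm (g k) / b) powr p))"
      by (rule sum_mono)
    also have "\<dots> = (a + b) powr (p - 1) *
        (a * (\<Sum>k\<in>F. (norm (f k) / a) powr p) + b * (\<Sum>k\<in>F. (norm (g k) / b) powr p))"
      by (simp only: sum.distrib flip: sum_distrib_left)
    also have "\<dots> \<le> (a + b) powr (p - 1) * (a + b)"
      using scaled[OF f F] scaled[OF g F] unfolding a_def[symmetric] b_def[symmetric]
      by (intro mult_left_mono add_mono) auto
    also have "\<dots> = (a + b) powr p"
      using powr_mult_base[of "a + b" "p - 1"] ab by (simp add: mult.commute)
    finally show ?thesis .
  qed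
  then show "(\<lambda>k. f k + g k) \<in> ell p" "ell_norm p (\<lambda>k. f k + g k) \<le> ell_norm p f + ell_norm p g"
    using ell_boundI[OF p, of "a + b" "\<lambda>k. f k + g k"] ab unfolding a_def[symmetric] b_def[symmetric]
    by simp_all
qed

lemma ell_norm_uminus: "ell_norm p (\<lambda>k. - f k) = ell_norm p f"
  by (simp add: ell_norm_def)

lemma ell_norm_minus_commute: "ell_norm p (\<lambda>k. f k - g k) = ell_norm p (\<lambda>k. g k - f k)"
  unfolding ell_norm_def
  by (intro arg_cong2[where f = "(powr)"] infsum_cong refl norm_minus_commute)

lemma ell_diff:
  assumes p: "1 \<le> p" and f: "f \<in> ell p" and g: "g \<in> ell p"
  shows ell_diff_mem: "(\<lambda>k. f k - g k) \<in> ell p"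
    and ell_norm_diff_le: "ell_norm p (\<lambda>k. f k - g k) \<le> ell_norm p f + ell_norm p g"
  using ell_add[OF p f ell_scale_mem[OF p g, of "-1"]] by (simp_all add: ell_norm_uminus)

lemma Metric_space_ell:
  assumes p: "1 \<le> p"
  shows "Metric_space (ell p) (ell_dist p)"
proof
  fix f g h :: "'a \<Rightarrow> complex"
  show "0 \<le> ell_dist p f g"
    by (simp add: ell_dist_def)
  show "ell_dist p f g = ell_dist p g f"
    unfolding ell_dist_def by (rule ell_norm_minus_commute)
  assume f: "f \<in> ell p" and g: "g \<in> ell p"
  show "ell_dist p f g = 0 \<longleftrightarrow> f = g"
    using ell_norm_eq_0_iff[OF p ell_diff_mem[OF p f g]] by (auto simp: ell_dist_def fun_eq_iff)
  assume h: "h \<in> ell p"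
  show "ell_dist p f h \<le> ell_dist p f g + ell_dist p g h"
    using ell_norm_triangle[OF p ell_diff_mem[OF p f g] ell_diff_mem[OF p g h]]
    by (simp add: ell_dist_def)
qed

section \<open>Completeness of \<open>ell p\<close> and a criterion for total boundedness\<close>

text \<open>Coordinates are dominated by the norm, so a Cauchy sequence converges pointwise. The
  Cauchy estimate passes to the pointwise limit on each finite set of coordinates, with a bound
  independent of that set.\<close>

lemma mcomplete_ell:
  assumes p: "1 \<le> p"
  shows "Metric_space.mcomplete (ell p :: ('a \<Rightarrow> complex) set) (ell_dist p)"
proof -
  interpret Metric_space "ell p :: ('a \<Rightarrow> complex) set" "ell_dist p"
    by (rule Metric_space_ell[OF p])
  show ?thesis
    unfolding mcomplete_def
  proof (intro allI impI)
    fix s :: "nat \<Rightarrow> 'a \<Rightarrow> complex"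
    assume "MCauchy s"
    then have mem: "\<And>n. s n \<in> ell p"
      and cauchy: "\<And>e. 0 < e \<Longrightarrow> \<exists>N. \<forall>m n. N \<le> m \<longrightarrow> N \<le> n \<longrightarrow> ell_norm p (\<lambda>k. s m k - s n k) < e"
      unfolding MCauchy_def ell_dist_def by auto
    have "\<exists>l. (\<lambda>n. s n k) \<longlonglongrightarrow> l" for k
    proof -
      have "Cauchy (\<lambda>n. s n k)"
      proof (rule metric_CauchyI)
        fix e :: real
        assume "0 < e"
        then obtain N where N: "\<And>m n. N \<le> m \<Longrightarrow> N \<le> n \<Longrightarrow> ell_norm p (\<lambda>k. s m k - s n k) < e"
          using cauchy[OF \<open>0 < e\<close>] by (elim exE) auto
        have "dist (s m k) (s n k) < e" if "N \<le> m" "N \<le> n" for m n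
          unfolding dist_norm
          by (rule order_le_less_trans[OF norm_le_ell_norm[OF p ell_diff_mem[OF p mem mem]] N[OF that]])
        then show "\<exists>M. \<forall>m\<ge>M. \<forall>n\<ge>M. dist (s m k) (s n k) < e"
          by (intro exI[of _ N] allI impI)
      qed
      then show ?thesis
        using Cauchy_convergent convergent_def by blast
    qed
    then obtain l where l: "\<And>k. (\<lambda>n. s n k) \<longlonglongrightarrow> l k"
      by metis
    have close: "\<exists>N. \<forall>m\<ge>N. (\<lambda>k. s m k - l k) \<in> ell p \<and> ell_norm p (\<lambda>k. s m k - l k) \<le> e"
      if e: "0 < e" for e
    proof -
      obtain N where N: "\<And>m n. N \<le> m \<Longrightarrow> N \<le> n \<Longrightarrow> ell_norm p (\<lambda>k. s m k - s n k) < e"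
        using cauchy[OF e] by (elim exE) auto
      \<comment> \<open>Here m and F stay fixed while n tends to infinity; finiteness of F allows
        the limit to be taken term by term.\<close>
      have "(\<Sum>k\<in>F. norm (s m k - l k) powr p) \<le> e powr p" if "N \<le> m" "finite F" for m F
      proof (rule LIMSEQ_le_const2)
        show "(\<lambda>n. \<Sum>k\<in>F. norm (s m k - s n k) powr p) \<longlonglongrightarrow> (\<Sum>k\<in>F. norm (s m k - l k) powr p)"
          using p by (intro tendsto_sum tendsto_powr' tendsto_norm tendsto_diff tendsto_const l) auto
        have "(\<Sum>k\<in>F. norm (s m k - s n k) powr p) \<le> e powr p" if "N \<le> n" for n
        proof -
          have "(\<Sum>k\<in>F. norm (s m k - s n k) powr p) \<le> ell_norm p (\<lambda>k. s m k - s n k) powr p"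
            by (rule sum_powr_le_ell_norm[OF p ell_diff_mem[OF p mem mem] \<open>finite F\<close>])
          also have "\<dots> \<le> e powr p"
            using p N[OF \<open>N \<le> m\<close> that] by (intro powr_mono2) auto
          finally show ?thesis .
        qed
        then show "\<exists>N. \<forall>n\<ge>N. (\<Sum>k\<in>F. norm (s m k - s n k) powr p) \<le> e powr p"
          by (intro exI[of _ N] allI impI)
      qed
      then show ?thesis
        using e by (intro exI[of _ N] allI impI conjI ell_boundI[OF p, of e]) auto
    qed
    \<comment> \<open>The limit is recovered as l = s N - (s N - l), a difference of two members of
      \<open>ell p\<close>.\<close>
    obtain N where "(\<lambda>k. s N k - l k) \<in> ell p"
      using close[of 1] by auto
    from ell_diff_mem[OF p mem[of N] this] have "l \<in> ell p"
      by simp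
    moreover have "\<exists>N. \<forall>n\<ge>N. s n \<in> ell p \<and> ell_dist p (s n) l < e" if e: "0 < e" for e
    proof -
      obtain N where N: "\<forall>m\<ge>N. (\<lambda>k. s m k - l k) \<in> ell p \<and> ell_norm p (\<lambda>k. s m k - l k) \<le> e / 2"
        using close[OF half_gt_zero[OF e]] by (rule exE)
      have "ell_dist p (s n) l < e" if "N \<le> n" for n
        using N[rule_format, OF that] e unfolding ell_dist_def by linarith
      then show ?thesis
        using mem by blast
    qed
    ultimately show "\<exists>l. limitin mtopology s l sequentially"
      unfolding limit_metric_sequentially by blast
  qed
qed

text \<open>
  Pigeonhole: a grid of mesh \<open>d\<close> in the finitely many coordinates of \<open>F\<close> has finitely many cells
  meeting \<open>S\<close>; one element of \<open>S\<close> per cell forms the net.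
\<close>

lemma mtotally_bounded_ellI:
  fixes S :: "('a \<Rightarrow> complex) set"
  assumes p: "1 \<le> p" and S: "S \<subseteq> ell p"
    and bounded: "\<And>k. \<exists>B. \<forall>f\<in>S. norm (f k) \<le> B"
    and tails: "\<And>e. 0 < e \<Longrightarrow> \<exists>F. finite F \<and> (\<forall>f\<in>S. ell_norm p (\<lambda>k. if k \<in> F then 0 else f k) \<le> e)"
  shows "Metric_space.mtotally_bounded (ell p) (ell_dist p) S"
proof -
  interpret Metric_space "ell p :: ('a \<Rightarrow> complex) set" "ell_dist p"
    by (rule Metric_space_ell[OF p])
  obtain B where B: "\<And>k f. f \<in> S \<Longrightarrow> norm (f k) \<le> B k"
    using bounded by metis
  show ?thesis
    unfolding mtotally_bounded_def
  proof (intro allI impI)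
    fix e :: real
    assume e: "0 < e"
    \<comment> \<open>The error budget is e/4 for the coordinates in F and e/4 for each of two
      tails, in total 3e/4 < e.\<close>
    then obtain F where F: "finite F"
      and tail: "\<And>f. f \<in> S \<Longrightarrow> ell_norm p (\<lambda>k. if k \<in> F then 0 else f k) \<le> e / 4"
      using tails[of "e / 4"] by auto
    \<comment> \<open>The mesh satisfies n * (2 * d) = e / 4. Adding 1 to the cardinality gives n >=
      1 even for empty F, so n <= n^p absorbs the number of terms.\<close>
    define n where "n = real (card F) + 1"
    define d where "d = e / (8 * n)"
    have n: "1 \<le> n" and d: "0 < d"
      using e by (auto simp: n_def d_def)
    \<comment> \<open>Restriction to F places the cell labels in an extensional product of finite
      boxes, which is finite.\<close>
    define cell where "cell f = (\<lambda>k\<in>F. (\<lfloor>Re (f k) / d\<rfloor>, \<lfloor>Im (f k) / d\<rfloor>))" for f :: "'a \<Rightarrow> complex"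
    define box where "box k = {- \<lceil>B k / d\<rceil> - 1..\<lceil>B k / d\<rceil>}" for k
    have floor_box: "\<lfloor>x / d\<rfloor> \<in> box k" if "\<bar>x\<bar> \<le> B k" for x k
    proof -
      have "x / d \<le> B k / d" "- (B k / d) \<le> x / d"
        using that d by (auto simp: field_simps)
      then show ?thesis
        unfolding box_def by (simp add: le_floor_iff) linarith
    qed
    have "cell ` S \<subseteq> (\<Pi>\<^sub>E k\<in>F. box k \<times> box k)"
      using order_trans[OF abs_Re_le_cmod B] order_trans[OF abs_Im_le_cmod B]
      by (auto simp: cell_def intro!: floor_box)
    moreover have "finite (\<Pi>\<^sub>E k\<in>F. box k \<times> box k)"
      using F by (intro finite_PiE) (auto simp: box_def)
    ultimately have fin: "finite (cell ` S)"
      by (rule finite_subset)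
    have close: "ell_dist p f g < e" if f: "f \<in> S" and g: "g \<in> S" and same: "cell f = cell g" for f g
    proof -
      let ?r = "\<lambda>k. if k \<in> F then f k - g k else 0"
      let ?f = "\<lambda>k. if k \<in> F then 0 else f k" and ?g = "\<lambda>k. if k \<in> F then 0 else g k"
      have floor_eq: "\<bar>x - y\<bar> \<le> d" if "\<lfloor>x / d\<rfloor> = \<lfloor>y / d\<rfloor>" for x y
      proof -
        have "\<bar>x / d - y / d\<bar> \<le> 1"
          using that by linarith
        then show ?thesis
          using d by (simp add: abs_divide flip: diff_divide_distrib)
      qed
      \<comment> \<open>Real and imaginary parts with the same floor differ by at most d
        each.\<close>
      have diff: "norm (f k - g k) \<le> 2 * d" if "k \<in> F" for k
      proof -
        have "\<lfloor>Re (f k) / d\<rfloor> = \<lfloor>Re (g k) / d\<rfloor>" "\<lfloor>Im (f k) / d\<rfloor> = \<lfloor>Im (g k) / d\<rfloor>"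
          using fun_cong[OF same, of k] that by (auto simp: cell_def)
        from this[THEN floor_eq] show ?thesis
          using cmod_le[of "f k - g k"] by simp
      qed
      have "(\<Sum>k\<in>G. norm (?r k) powr p) \<le> (e / 4) powr p" if G: "finite G" for G
      proof -
        have "(\<Sum>k\<in>G. norm (?r k) powr p) = (\<Sum>k\<in>G \<inter> F. norm (f k - g k) powr p)"
          using G p by (intro sum.mono_neutral_cong_right) auto
        also have "\<dots> \<le> (\<Sum>k\<in>G \<inter> F. (2 * d) powr p)"
          using diff p by (intro sum_mono powr_mono2) auto
        also have "\<dots> \<le> n * (2 * d) powr p"
          using card_mono[OF F, of "G \<inter> F"] by (auto simp: n_def intro!: mult_right_mono)
        also have "\<dots> \<le> n powr p * (2 * d) powr p"
          using powr_mono[OF p n] n by (intro mult_right_mono) auto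
        also have "\<dots> = (e / 4) powr p"
          using n d e by (simp add: d_def flip: powr_mult)
        finally show ?thesis .
      qed
      note r = ell_boundI[OF p _ this, simplified]
      have f_tail: "?f \<in> ell p" and g_tail: "?g \<in> ell p"
        using S f g by (auto intro: ell_mono_mem[OF p])
      have "(\<lambda>k. f k - g k) = (\<lambda>k. ?r k + (?f k - ?g k))"
        by auto
      then have "ell_dist p f g = ell_norm p (\<lambda>k. ?r k + (?f k - ?g k))"
        unfolding ell_dist_def by (rule arg_cong)
      also have "\<dots> \<le> ell_norm p ?r + (ell_norm p ?f + ell_norm p ?g)"
        using ell_norm_triangle[OF p r(1) ell_diff_mem[OF p f_tail g_tail]]
          ell_norm_diff_le[OF p f_tail g_tail] e by linarith
      also have "\<dots> \<le> e / 4 + (e / 4 + e / 4)"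
        using r(2) tail[OF f] tail[OF g] e by (intro add_mono) auto
      also have "\<dots> < e"
        using e by simp
      finally show ?thesis .
    qed
    let ?K = "inv_into S cell ` cell ` S"
    have "f \<in> (\<Union>g\<in>?K. mball g e)" if f: "f \<in> S" for f
    proof -
      have "cell f \<in> cell ` S"
        using f by simp
      then have "inv_into S cell (cell f) \<in> S" "cell (inv_into S cell (cell f)) = cell f"
        by (rule inv_into_into, rule f_inv_into_f)
      then have "f \<in> mball (inv_into S cell (cell f)) e"
        using close f S by auto
      then show ?thesis
        using f by blast
    qed
    then show "\<exists>K. finite K \<and> K \<subseteq> S \<and> S \<subseteq> (\<Union>x\<in>K. mball x e)"
      using fin by (intro exI[of _ ?K]) (auto intro: inv_into_into)
  qed
qed

section \<open>Approximation by finite support and uniqueness of the extension\<close>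

lemma mem_ell_1: "f \<in> ell 1 \<longleftrightarrow> (\<lambda>k. norm (f k)) summable_on UNIV"
  by (simp add: ell_def)

text \<open>Every coordinate is at most the \<open>ell 1\<close> norm N, so p - 1 of the p factors
  can be bounded by N, leaving a multiple of the summable |f|.\<close>

lemma ell_1_subset:
  assumes p: "1 \<le> p" and f: "f \<in> ell 1"
  shows "f \<in> ell p"
proof -
  define N where "N = ell_norm 1 f"
  have "(\<lambda>k. norm (f k) powr p) summable_on UNIV"
  proof (rule summable_on_comparison_test)
    show "(\<lambda>k. N powr (p - 1) * norm (f k)) summable_on UNIV"
      using f by (intro summable_on_cmult_right) (simp add: mem_ell_1)
    fix k
    have "norm (f k) powr p = norm (f k) * norm (f k) powr (p - 1)"
      by (simp add: powr_mult_base)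
    also have "\<dots> \<le> norm (f k) * N powr (p - 1)"
      using norm_le_ell_norm[OF _ f] p by (intro mult_left_mono powr_mono2) (auto simp: N_def)
    finally show "norm (f k) powr p \<le> N powr (p - 1) * norm (f k)"
      by (simp add: mult.commute)
  qed simp
  then show ?thesis
    by (simp add: ell_def)
qed

lemma finite_support_mem_ell:
  assumes "finite F"
  shows "(\<lambda>k. if k \<in> F then f k else 0) \<in> ell p"
  unfolding ell_def mem_Collect_eq
  by (rule finite_nonzero_values_imp_summable_on) (rule finite_subset[OF _ assms], auto)

text \<open>F is chosen with its partial sum of p-th powers within e^p of the total; any finite set
  disjoint from F then contributes at most e^p.\<close>

lemma ell_tail_small:
  assumes p: "1 \<le> p" and f: "f \<in> ell p" and e: "0 < e"
  obtains F where "finite F" "ell_norm p (\<lambda>k. if k \<in> F then 0 else f k) \<le> e"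
proof -
  let ?g = "\<lambda>k. norm (f k) powr p"
  have g: "?g summable_on UNIV"
    using f by (simp add: ell_def)
  obtain F where F: "finite F" "dist (sum ?g F) (infsum ?g UNIV) \<le> e powr p"
    using infsum_finite_approximation[OF g, of "e powr p"] e by auto
  have "(\<Sum>k\<in>G. norm (if k \<in> F then 0 else f k) powr p) \<le> e powr p" if G: "finite G" for G
  proof -
    have "(\<Sum>k\<in>G. norm (if k \<in> F then 0 else f k) powr p) = sum ?g (G - F)"
      using G p by (intro sum.mono_neutral_cong_right) auto
    moreover have "sum ?g (G - F) + sum ?g F = sum ?g (G \<union> F)"
      using G F(1) by (subst sum.union_disjoint[symmetric]) auto
    moreover have "sum ?g (G \<union> F) \<le> infsum ?g UNIV"
      using G F(1) g by (intro finite_sum_le_infsum) auto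
    ultimately show ?thesis
      using F(2) by (simp add: dist_real_def)
  qed
  then have "ell_norm p (\<lambda>k. if k \<in> F then 0 else f k) \<le> e"
    using e by (intro ell_norm_leI[OF p]) auto
  with F(1) show ?thesis
    by (rule that)
qed

text \<open>Finite truncations lie in \<open>ell 1\<close>, where both operators equal
  \<open>S\<close>. The difference at \<open>f\<close> is therefore the difference at a tail of
  \<open>f\<close>, which boundedness makes arbitrarily small. Off \<open>ell p\<close> both
  functions are \<open>undefined\<close>.\<close>

lemma density_extension_unique:
  fixes T T' :: "('a \<Rightarrow> complex) \<Rightarrow> 'a \<Rightarrow> complex"
  assumes p: "1 \<le> p" and T: "density_extension p S T" and T': "density_extension p S T'"
  shows "T = T'"
proof (rule extensionalityI)
  show "T \<in> extensional (ell p)" "T' \<in> extensional (ell p)"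
    using T T' by (auto simp: density_extension_def)
  fix f :: "'a \<Rightarrow> complex"
  assume f: "f \<in> ell p"
  obtain C C' where C: "\<And>f. f \<in> ell p \<Longrightarrow> ell_norm p (T f) \<le> C * ell_norm p f"
    and C': "\<And>f. f \<in> ell p \<Longrightarrow> ell_norm p (T' f) \<le> C' * ell_norm p f"
    using T T' unfolding density_extension_def bounded_operator_def by blast
  have mem: "\<And>f. f \<in> ell p \<Longrightarrow> T f \<in> ell p" "\<And>f. f \<in> ell p \<Longrightarrow> T' f \<in> ell p"
    using T T' unfolding density_extension_def bounded_operator_def linear_on_ell_def by auto
  have add: "\<And>f g. f \<in> ell p \<Longrightarrow> g \<in> ell p \<Longrightarrow> T (\<lambda>k. f k + g k) = (\<lambda>k. T f k + T g k)"
    "\<And>f g. f \<in> ell p \<Longrightarrow> g \<in> ell p \<Longrightarrow> T' (\<lambda>k. f k + g k) = (\<lambda>k. T' f k + T' g k)"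
    using T T' unfolding density_extension_def bounded_operator_def linear_on_ell_def by auto
  have small: "ell_norm p (\<lambda>k. T f k - T' f k) \<le> (\<bar>C\<bar> + \<bar>C'\<bar>) * e" if e: "0 < e" for e
  proof -
    obtain F where F: "finite F" "ell_norm p (\<lambda>k. if k \<in> F then 0 else f k) \<le> e"
      using ell_tail_small[OF p f e] .
    let ?h = "\<lambda>k. if k \<in> F then f k else 0" and ?t = "\<lambda>k. if k \<in> F then 0 else f k"
    have h: "?h \<in> ell p" "?h \<in> ell 1"
      by (rule finite_support_mem_ell[OF F(1)])+
    have t: "?t \<in> ell p"
      by (rule ell_mono_mem[OF p f]) auto
    have split: "f = (\<lambda>k. ?h k + ?t k)"
      by auto
    have "T ?h = T' ?h"
      using T T' h(2) by (simp add: density_extension_def)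
    then have "(\<lambda>k. T f k - T' f k) = (\<lambda>k. T ?t k - T' ?t k)"
      using add[OF h(1) t] unfolding split[symmetric] by simp
    then have "ell_norm p (\<lambda>k. T f k - T' f k) \<le> ell_norm p (T ?t) + ell_norm p (T' ?t)"
      using ell_norm_diff_le[OF p mem(1)[OF t] mem(2)[OF t]] by simp
    also have "\<dots> \<le> \<bar>C\<bar> * ell_norm p ?t + \<bar>C'\<bar> * ell_norm p ?t"
      \<comment> \<open>Absolute values are taken because \<open>bounded_operator\<close> does not
        fix the sign of its constant.\<close>
      by (intro add_mono order_trans[OF C[OF t]] order_trans[OF C'[OF t]] mult_right_mono) auto
    also have "\<dots> \<le> (\<bar>C\<bar> + \<bar>C'\<bar>) * e"
      using F(2) by (simp add: distrib_right add_mono mult_left_mono)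
    finally show ?thesis .
  qed
  have "ell_norm p (\<lambda>k. T f k - T' f k) \<le> 0"
  proof (rule field_le_epsilon)
    fix e :: real
    assume e: "0 < e"
    \<comment> \<open>The added 1 keeps the denominator positive when both constants are
      zero.\<close>
    have "(\<bar>C\<bar> + \<bar>C'\<bar>) * (e / (\<bar>C\<bar> + \<bar>C'\<bar> + 1)) \<le> e"
      using e by (simp add: field_simps)
    then show "ell_norm p (\<lambda>k. T f k - T' f k) \<le> 0 + e"
      using small[of "e / (\<bar>C\<bar> + \<bar>C'\<bar> + 1)"] e by (simp add: add_nonneg_pos)
  qed
  then have "(\<lambda>k. T f k - T' f k) = (\<lambda>k. 0)"
    using ell_norm_eq_0_iff[OF p ell_diff_mem[OF p mem(1)[OF f] mem(2)[OF f]]]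
    by (simp add: antisym)
  then show "T f = T' f"
    by (auto simp: fun_eq_iff)
qed

subsection \<open>Operators with a kernel dominated by a convolution\<close>

text \<open>Used to interchange a finite sum over k with the infinite sum over j in Young's
  inequality.\<close>

lemma has_sum_sum:
  fixes g :: "'i \<Rightarrow> 'a \<Rightarrow> 'b::topological_comm_monoid_add"
  assumes "finite F" "\<And>i. i \<in> F \<Longrightarrow> (g i has_sum s i) A"
  shows "((\<lambda>x. \<Sum>i\<in>F. g i x) has_sum (\<Sum>i\<in>F. s i)) A"
  using assms by (induction F) (auto intro!: has_sum_add)

text \<open>Jensen with weights \<open>w\<close> bounds the p-th power of each value by W^(p-1)
  times a weighted sum of p-th powers; summing over k first then gives Young's inequality. The cast
  to complex numbers is there because \<open>ell\<close> consists of complex functions.\<close>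

lemma ell_convolution:
  fixes f :: "'a::ab_group_add \<Rightarrow> complex" and w :: "'a \<Rightarrow> real"
  assumes p: "1 \<le> p" and w0: "\<And>j. 0 \<le> w j" and w: "w summable_on UNIV" and f: "f \<in> ell p"
  shows ell_convolution_summable: "(\<lambda>j. w j * norm (f (k + j))) summable_on UNIV"
    and ell_convolution_mem: "(\<lambda>k. complex_of_real (\<Sum>\<^sub>\<infinity>j. w j * norm (f (k + j)))) \<in> ell p"
    and ell_norm_convolution_le:
      "ell_norm p (\<lambda>k. complex_of_real (\<Sum>\<^sub>\<infinity>j. w j * norm (f (k + j)))) \<le> infsum w UNIV * ell_norm p f"
proof -
  define N W where "N = ell_norm p f" and "W = infsum w UNIV"
  have W0: "0 \<le> W"
    by (simp add: W_def infsum_nonneg w0)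
  have summ: "(\<lambda>j. w j * norm (f (k + j)) powr p) summable_on UNIV" for k
  proof (rule summable_on_comparison_test)
    show "(\<lambda>j. w j * N powr p) summable_on UNIV"
      by (rule summable_on_cmult_left[OF w])
    show "w j * norm (f (k + j)) powr p \<le> w j * N powr p" for j
      using norm_le_ell_norm[OF p f] p w0 by (auto simp: N_def intro!: mult_left_mono powr_mono2)
  qed (simp add: w0)
  note jensen = jensen_powr_infsum[OF p w0 norm_ge_zero w summ]
  show "(\<lambda>j. w j * norm (f (k + j))) summable_on UNIV" for k
    by (rule jensen(1))
  have "(\<Sum>k\<in>F. norm (complex_of_real (\<Sum>\<^sub>\<infinity>j. w j * norm (f (k + j)))) powr p) \<le> (W * N) powr p"
    if F: "finite F" for F
  proof -
    have "(\<Sum>k\<in>F. norm (complex_of_real (\<Sum>\<^sub>\<infinity>j. w j * norm (f (k + j)))) powr p)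
        = (\<Sum>k\<in>F. (\<Sum>\<^sub>\<infinity>j. w j * norm (f (k + j))) powr p)"
      by (simp add: infsum_nonneg w0)
    also have "\<dots> \<le> (\<Sum>k\<in>F. W powr (p - 1) * (\<Sum>\<^sub>\<infinity>j. w j * norm (f (k + j)) powr p))"
      unfolding W_def by (intro sum_mono jensen(2))
    also have "\<dots> = W powr (p - 1) * (\<Sum>k\<in>F. \<Sum>\<^sub>\<infinity>j. w j * norm (f (k + j)) powr p)"
      by (simp only: sum_distrib_left)
    also have "(\<Sum>k\<in>F. \<Sum>\<^sub>\<infinity>j. w j * norm (f (k + j)) powr p) \<le> W * N powr p"
    proof (rule has_sum_mono)
      show "((\<lambda>j. \<Sum>k\<in>F. w j * norm (f (k + j)) powr p) has_sum
          (\<Sum>k\<in>F. \<Sum>\<^sub>\<infinity>j. w j * norm (f (k + j)) powr p)) UNIV"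
        by (intro has_sum_sum F has_sum_infsum summ)
      show "((\<lambda>j. w j * N powr p) has_sum W * N powr p) UNIV"
        unfolding W_def by (intro has_sum_cmult_left has_sum_infsum w)
      fix j
      \<comment> \<open>Translation by j is injective, so the shifted finite sum is again a partial
        sum for \<open>f\<close>, bounded uniformly in j.\<close>
      have "(\<Sum>k\<in>F. norm (f (k + j)) powr p) = (\<Sum>k\<in>(\<lambda>k. k + j) ` F. norm (f k) powr p)"
        by (simp add: sum.reindex)
      also have "\<dots> \<le> N powr p"
        unfolding N_def using F by (intro sum_powr_le_ell_norm[OF p f]) simp
      finally show "(\<Sum>k\<in>F. w j * norm (f (k + j)) powr p) \<le> w j * N powr p"
        by (simp add: mult_left_mono w0 flip: sum_distrib_left)
    qed
    also have "W powr (p - 1) * (W * N powr p) = (W * N) powr p"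
      using powr_mult_base[OF W0, of "p - 1"] W0 by (simp add: N_def powr_mult mult.left_commute mult.commute)
    finally show ?thesis
      by (simp add: mult_left_mono)
  qed
  note bound = ell_boundI[OF p mult_nonneg_nonneg[OF W0 ell_norm_nonneg] this[unfolded N_def]]
  show "(\<lambda>k. complex_of_real (\<Sum>\<^sub>\<infinity>j. w j * norm (f (k + j)))) \<in> ell p"
    "ell_norm p (\<lambda>k. complex_of_real (\<Sum>\<^sub>\<infinity>j. w j * norm (f (k + j)))) \<le> infsum w UNIV * ell_norm p f"
    unfolding W_def[symmetric] by (rule bound, assumption)+
qed

definition kernel_op :: "('a \<Rightarrow> 'a \<Rightarrow> complex) \<Rightarrow> ('a \<Rightarrow> complex) \<Rightarrow> 'a \<Rightarrow> complex" where
  "kernel_op K f k = (\<Sum>\<^sub>\<infinity>m. K k m * f m)"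

section \<open>Compactness of matrix operators whose row weights vanish at infinity\<close>

context
  fixes K :: "'a::ab_group_add \<Rightarrow> 'a \<Rightarrow> complex" and lam w :: "'a \<Rightarrow> real" and p :: real
  assumes p: "1 \<le> p" and w0: "\<And>j. 0 \<le> w j" and w: "w summable_on UNIV"
    and K: "\<And>k m. norm (K k m) \<le> lam k * w (m - k)"
    and lam: "\<And>e. 0 < e \<Longrightarrow> finite {k. e < lam k}"
begin

text \<open>The substitution m = k + j turns the bound on row k of the matrix into
  \<open>lam k\<close> times the convolution value at k, which also gives absolute convergence of
  the row sum.\<close>

lemma kernel_op_pointwise:
  assumes f: "f \<in> ell p"
  shows kernel_op_summable: "(\<lambda>m. K k m * f m) summable_on UNIV"
    and norm_kernel_op_le: "norm (kernel_op K f k) \<le> lam k * (\<Sum>\<^sub>\<infinity>j. w j * norm (f (k + j)))"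
proof -
  have "((\<lambda>j. w j * norm (f (k + j))) has_sum (\<Sum>\<^sub>\<infinity>j. w j * norm (f (k + j)))) UNIV"
    by (rule has_sum_infsum[OF ell_convolution_summable[OF p w0 w f]])
  also have "?this \<longleftrightarrow>
      ((\<lambda>m. w (m - k) * norm (f m)) has_sum (\<Sum>\<^sub>\<infinity>j. w j * norm (f (k + j)))) UNIV"
    by (rule has_sum_reindex_bij_witness[where i = "\<lambda>m. m - k" and j = "\<lambda>j. k + j"]) auto
  finally have major: "((\<lambda>m. lam k * (w (m - k) * norm (f m))) has_sum
      (lam k * (\<Sum>\<^sub>\<infinity>j. w j * norm (f (k + j))))) UNIV"
    by (rule has_sum_cmult_right)
  have le: "norm (K k m * f m) \<le> lam k * (w (m - k) * norm (f m))" for m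
    using mult_right_mono[OF K norm_ge_zero, of k m "f m"] by (simp add: norm_mult mult.assoc)
  show "(\<lambda>m. K k m * f m) summable_on UNIV"
    by (rule abs_summable_summable,
        rule Infinite_Sum.abs_summable_on_comparison_test'[OF has_sum_imp_summable[OF major] le])
  from has_sum_infsum[OF this]
  show "norm (kernel_op K f k) \<le> lam k * (\<Sum>\<^sub>\<infinity>j. w j * norm (f (k + j)))"
    unfolding kernel_op_def by (rule norm_infsum_le[OF _ major le])
qed

text \<open>One estimate with two uses: F = {} and c a bound for \<open>lam\<close> give boundedness
  of the operator; F = {k. c < lam k} with small c gives the uniform tails for compactness.\<close>

lemma kernel_op_outside:
  assumes f: "f \<in> ell p" and c: "0 \<le> c" "\<And>k. k \<notin> F \<Longrightarrow> lam k \<le> c"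
  shows kernel_op_outside_mem: "(\<lambda>k. if k \<in> F then 0 else kernel_op K f k) \<in> ell p"
    and ell_norm_kernel_op_outside:
      "ell_norm p (\<lambda>k. if k \<in> F then 0 else kernel_op K f k) \<le> c * infsum w UNIV * ell_norm p f"
proof -
  let ?v = "\<lambda>k. complex_of_real (\<Sum>\<^sub>\<infinity>j. w j * norm (f (k + j)))"
  have v: "?v \<in> ell p" "ell_norm p ?v \<le> infsum w UNIV * ell_norm p f"
    using ell_convolution[OF p w0 w f] by auto
  have le: "norm (if k \<in> F then 0 else kernel_op K f k) \<le> norm (of_real c * ?v k)" for k
  proof (cases "k \<in> F")
    case False
    have nonneg: "0 \<le> (\<Sum>\<^sub>\<infinity>j. w j * norm (f (k + j)))"
      by (simp add: infsum_nonneg w0)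
    have "norm (kernel_op K f k) \<le> c * (\<Sum>\<^sub>\<infinity>j. w j * norm (f (k + j)))"
      using norm_kernel_op_le[OF f, of k] mult_right_mono[OF c(2)[OF False] nonneg] by linarith
    then show ?thesis
      using False c(1) nonneg by (simp add: norm_mult)
  qed simp
  show "(\<lambda>k. if k \<in> F then 0 else kernel_op K f k) \<in> ell p"
    by (rule ell_mono_mem[OF p ell_scale_mem[OF p v(1)] le])
  have "ell_norm p (\<lambda>k. if k \<in> F then 0 else kernel_op K f k) \<le> ell_norm p (\<lambda>k. of_real c * ?v k)"
    by (rule ell_norm_mono[OF p ell_scale_mem[OF p v(1)] le])
  also have "\<dots> \<le> c * ell_norm p ?v"
    using ell_norm_scale_le[OF p v(1), of "of_real c"] c(1) by simp
  also have "\<dots> \<le> c * (infsum w UNIV * ell_norm p f)"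
    by (rule mult_left_mono[OF v(2) c(1)])
  finally show "ell_norm p (\<lambda>k. if k \<in> F then 0 else kernel_op K f k) \<le> c * infsum w UNIV * ell_norm p f"
    by (simp add: mult.assoc)
qed

text \<open>Only finitely many values exceed 1, so the maximum of these and 1 is a bound.\<close>

lemma lam_bounded: "\<exists>M\<ge>0. \<forall>k. lam k \<le> M"
proof -
  define M where "M = Max (insert 1 (lam ` {k. 1 < lam k}))"
  have fin: "finite (insert 1 (lam ` {k. 1 < lam k}))"
    using lam[of 1] by simp
  have "1 \<le> M"
    unfolding M_def using fin by (rule Max_ge) simp
  moreover have "lam k \<le> M" if "1 < lam k" for k
    unfolding M_def using fin by (rule Max_ge) (simp add: that)
  ultimately show ?thesis
    by (intro exI[of _ M]) (meson linorder_not_le order_trans zero_le_one)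
qed

lemma kernel_op_mem:
  assumes f: "f \<in> ell p"
  shows "kernel_op K f \<in> ell p"
proof -
  obtain M where "0 \<le> M" "\<And>k. lam k \<le> M"
    using lam_bounded by blast
  then show ?thesis
    using kernel_op_outside_mem[OF f, of M "{}"] by simp
qed

lemma kernel_op_bounded: "\<exists>C\<ge>0. \<forall>f\<in>ell p. ell_norm p (kernel_op K f) \<le> C * ell_norm p f"
proof -
  obtain M where M: "0 \<le> M" "\<And>k. lam k \<le> M"
    using lam_bounded by blast
  have "0 \<le> M * infsum w UNIV"
    using M(1) by (simp add: infsum_nonneg w0)
  moreover have "ell_norm p (kernel_op K f) \<le> M * infsum w UNIV * ell_norm p f" if "f \<in> ell p" for f
    using ell_norm_kernel_op_outside[OF that M, of "{}"] by simp
  ultimately show ?thesis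
    by blast
qed

text \<open>Additivity rests on convergence of the row sums. The restriction makes the operator
  \<open>undefined\<close> off \<open>ell p\<close>, as \<open>density_extension\<close>
  demands.\<close>

lemma linear_on_kernel_op: "linear_on_ell p (restrict (kernel_op K) (ell p))"
  unfolding linear_on_ell_def
proof (intro conjI ballI allI)
  fix f g :: "'a \<Rightarrow> complex"
  assume f: "f \<in> ell p" and g: "g \<in> ell p"
  have "kernel_op K (\<lambda>k. f k + g k) k = kernel_op K f k + kernel_op K g k" for k
    unfolding kernel_op_def distrib_left
    by (rule infsum_add[OF kernel_op_summable[OF f] kernel_op_summable[OF g]])
  then show "restrict (kernel_op K) (ell p) (\<lambda>k. f k + g k) =
      (\<lambda>k. restrict (kernel_op K) (ell p) f k + restrict (kernel_op K) (ell p) g k)"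
    using f g ell_add_mem[OF p f g] by auto
next
  fix c :: complex and f :: "'a \<Rightarrow> complex"
  assume f: "f \<in> ell p"
  have "kernel_op K (\<lambda>k. c * f k) k = c * kernel_op K f k" for k
    unfolding kernel_op_def mult.left_commute[of _ c] by (rule infsum_cmult_right')
  then show "restrict (kernel_op K) (ell p) (\<lambda>k. c * f k) =
      (\<lambda>k. c * restrict (kernel_op K) (ell p) f k)"
    using f ell_scale_mem[OF p f] by auto
qed (use kernel_op_mem in auto)

lemma bounded_operator_kernel_op: "bounded_operator p (restrict (kernel_op K) (ell p))"
  unfolding bounded_operator_def using linear_on_kernel_op kernel_op_bounded by auto

lemma compact_operator_kernel_op: "compact_operator p (restrict (kernel_op K) (ell p))"
proof -
  interpret Metric_space "ell p :: ('a \<Rightarrow> complex) set" "ell_dist p"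
    by (rule Metric_space_ell[OF p])
  obtain C where C: "0 \<le> C"
    and norm_le: "\<And>f. f \<in> ell p \<Longrightarrow> ell_norm p (kernel_op K f) \<le> C * ell_norm p f"
    using kernel_op_bounded by blast
  have "compactin mtopology (mtopology closure_of (restrict (kernel_op K) (ell p) ` B))"
    if "mbounded B" for B
  proof -
    from that obtain g r where B: "B \<subseteq> mcball g r" and r: "0 < r"
      unfolding mbounded_pos by blast
    define R where "R = ell_norm p g + r"
    have R: "0 < R"
      using r ell_norm_nonneg[of p g] by (simp add: R_def add_nonneg_pos)
    have mem_B: "f \<in> ell p" and norm_B: "ell_norm p f \<le> R" if "f \<in> B" for f
    proof -
      have g: "g \<in> ell p" and f: "f \<in> ell p" and d: "ell_norm p (\<lambda>k. g k - f k) \<le> r"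
        using B that by (auto simp: ell_dist_def)
      from f show "f \<in> ell p" .
      show "ell_norm p f \<le> R"
        using ell_norm_diff_le[OF p g ell_diff_mem[OF p g f]] d by (simp add: R_def)
    qed
    have "mtotally_bounded (restrict (kernel_op K) (ell p) ` B)"
    proof (rule mtotally_bounded_ellI[OF p])
      show "restrict (kernel_op K) (ell p) ` B \<subseteq> ell p"
        using kernel_op_mem mem_B by auto
      have "norm (kernel_op K f k) \<le> C * R" if "f \<in> B" for f k
        using norm_le_ell_norm[OF p kernel_op_mem[OF mem_B[OF that]], of k] norm_le[OF mem_B[OF that]]
          mult_left_mono[OF norm_B[OF that] C] by linarith
      then show "\<exists>b. \<forall>f\<in>restrict (kernel_op K) (ell p) ` B. norm (f k) \<le> b" for k
        using mem_B by (intro exI[of _ "C * R"]) auto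
      fix e :: real
      assume e: "0 < e"
      define W where "W = infsum w UNIV"
      have W: "0 \<le> W"
        by (simp add: W_def infsum_nonneg w0)
      \<comment> \<open>Chosen so that c * (W + 1) * R = e; W + 1 and the positive R keep the
        denominator nonzero even if W = 0. The exceptional set {k. c < lam k} depends on
        \<open>B\<close> only through R, hence serves all of \<open>B\<close> at once.\<close>
      define c where "c = e / ((W + 1) * R)"
      have c: "0 < c"
        using e W R by (simp add: c_def)
      have "ell_norm p (\<lambda>k. if k \<in> {k. c < lam k} then 0 else kernel_op K f k) \<le> e" if "f \<in> B" for f
      proof -
        have "ell_norm p (\<lambda>k. if k \<in> {k. c < lam k} then 0 else kernel_op K f k) \<le> c * W * ell_norm p f"
          unfolding W_def using c by (intro ell_norm_kernel_op_outside mem_B that) auto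
        also have "\<dots> \<le> c * (W + 1) * R"
          using c W norm_B[OF that] by (intro mult_mono) auto
        also have "\<dots> = e"
          using W R by (simp add: c_def)
        finally show ?thesis .
      qed
      then show "\<exists>F. finite F \<and> (\<forall>f\<in>restrict (kernel_op K) (ell p) ` B.
          ell_norm p (\<lambda>k. if k \<in> F then 0 else f k) \<le> e)"
        using lam[OF c] mem_B by (intro exI[of _ "{k. c < lam k}"]) auto
    qed
    then show ?thesis
      \<comment> \<open>In a complete space, total boundedness of the image is the same as
        compactness of its closure.\<close>
      using mtotally_bounded_eq_compact_closure_of[OF mcomplete_ell[OF p]] by blast
  qed
  then show ?thesis
    unfolding compact_operator_def ell_topology_def using linear_on_kernel_op by blast
qed

end

subsection \<open>The matrix of a pseudo-difference operator\<close>

lemma norm_character [simp]: "norm (character k x) = 1"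
proof -
  have "2 * complex_of_real pi * \<i> * complex_of_real (real_vec k \<bullet> x)
      = \<i> * complex_of_real (2 * pi * (real_vec k \<bullet> x))"
    by simp
  then show ?thesis
    unfolding character_def by (simp only: norm_exp_i_times)
qed

lemma character_add: "character (k + l) x = character k x * character l x"
proof -
  have "real_vec (k + l) \<bullet> x = real_vec k \<bullet> x + real_vec l \<bullet> x"
    by (simp add: real_vec_def inner_vec_def distrib_right sum.distrib)
  then show ?thesis
    by (simp add: character_def distrib_left exp_add)
qed

lemma character_measurable: "character k \<in> borel_measurable torus_measure"
proof -
  have "character k \<in> borel_measurable borel"
    unfolding character_def by (intro borel_measurable_continuous_onI continuous_intros)
  then show ?thesis
    unfolding torus_measure_def
    by (intro measurable_restrict_space1 measurable_completion) simp
qed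

text \<open>The half-open cube is Borel and bounded. Finiteness supplies the sigma-finiteness that
  Fubini's theorem asks of the torus factor.\<close>

lemma finite_measure_torus: "finite_measure (torus_measure :: (real ^ 'n) measure)"
proof -
  let ?S = "{x :: real ^ 'n. \<forall>i. 0 \<le> x $ i \<and> x $ i < 1}"
  have "?S = (\<Inter>i. {x. 0 \<le> x $ i} \<inter> {x. x $ i < 1})"
    by auto
  also have "\<dots> \<in> sets borel"
    by (intro sets.finite_INT) (auto intro!: borel_closed borel_open sets.Int
        closed_halfspace_component_ge_cart open_halfspace_component_lt_cart)
  finally have "?S \<in> sets lebesgue"
    by (simp add: sets_completionI_sets)
  moreover have "bounded ?S"
    by (rule bounded_subset[OF bounded_cbox[of 0 1]]) (auto simp: mem_box_cart less_imp_le)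
  ultimately show ?thesis
    unfolding torus_measure_def
    by (intro finite_measure_lebesgue_on bounded_set_imp_lmeasurable) auto
qed

text \<open>A lattice sum is an integral for counting measure, so the interchange is Fubini's
  theorem on a product measure. Characters have modulus 1, hence the integrand has norm
  \<open>norm (\<sigma> k x) * norm (f m)\<close>, a product of integrable functions.\<close>

lemma Op_eq_infsum:
  fixes \<sigma> :: "int ^ 'n \<Rightarrow> real ^ 'n \<Rightarrow> complex"
  assumes \<sigma>: "integrable torus_measure (\<sigma> k)" and f: "f \<in> ell 1"
  shows "Op \<sigma> f k = (\<Sum>\<^sub>\<infinity>m. fourier_symbol \<sigma> k (m - k) * f m)"
proof -
  let ?C = "count_space UNIV :: (int ^ 'n) measure"
  interpret C: sigma_finite_measure ?C
    by (intro sigma_finite_measure_count_space_countable) simp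
  interpret T: finite_measure "torus_measure :: (real ^ 'n) measure"
    by (rule finite_measure_torus)
  interpret pair_sigma_finite ?C "torus_measure :: (real ^ 'n) measure" ..
  define h where "h m x = character k x * \<sigma> k x * (character (- m) x * f m)" for m x
  have norm_h: "norm (h m x) = norm (\<sigma> k x) * norm (f m)" for m x
    by (simp add: h_def norm_mult)
  have f_abs: "(\<lambda>m. norm (f m)) summable_on UNIV"
    using f by (simp add: mem_ell_1)
  have f_int: "integrable ?C (\<lambda>m. norm (f m))"
    using f_abs abs_summable_equivalent[of f UNIV] by (simp add: abs_summable_on_def integrable_norm_iff)
  have h_meas: "h m \<in> borel_measurable torus_measure" for m
    unfolding h_def using \<sigma>
    by (intro borel_measurable_times character_measurable borel_measurable_const) auto
  have h_int: "integrable torus_measure (h m)" for m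
  proof (rule Bochner_Integration.integrable_bound)
    show "integrable torus_measure (\<lambda>x. norm (\<sigma> k x) * norm (f m))"
      using \<sigma> by simp
  qed (simp_all add: h_meas norm_h)
  have "integrable (?C \<Otimes>\<^sub>M torus_measure) (case_prod h)"
  proof (rule Fubini_integrable)
    \<comment> \<open>Since the lattice is countable, measurability in x for each fixed m gives
      joint measurability.\<close>
    show "case_prod h \<in> borel_measurable (?C \<Otimes>\<^sub>M torus_measure)"
      by (rule measurable_pair_measure_countable1) (simp_all add: h_meas)
    show "integrable ?C (\<lambda>m. \<integral>x. norm (case (m, x) of (m, x) \<Rightarrow> h m x) \<partial>torus_measure)"
      using f_int by (simp add: norm_h)
  qed (simp add: h_int)
  note swap = Fubini_integral[OF this]
  have sum_h: "(\<integral>m. h m x \<partial>?C) = character k x * \<sigma> k x * fourier_series f x" for x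
  proof -
    have "(\<lambda>m. norm (h m x)) summable_on UNIV"
      unfolding norm_h by (rule summable_on_cmult_right[OF f_abs])
    then have "(\<integral>m. h m x \<partial>?C) = (\<Sum>\<^sub>\<infinity>m. h m x)"
      using infsetsum_infsum[of "\<lambda>m. h m x" UNIV] abs_summable_equivalent[of "\<lambda>m. h m x" UNIV]
      by (simp add: infsetsum_def)
    then show ?thesis
      unfolding h_def fourier_series_def by (simp only: infsum_cmult_right')
  qed
  have int_h: "(\<integral>x. h m x \<partial>torus_measure) = fourier_symbol \<sigma> k (m - k) * f m" for m
  proof -
    \<comment> \<open>Multiplying the characters of k and -m produces the shifted frequency m -
      k.\<close>
    have "h m x = (character (- (m - k)) x * \<sigma> k x) * f m" for x
      using character_add[of k "- m" x] by (simp add: h_def)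
    then show ?thesis
      unfolding fourier_symbol_def by simp
  qed
  \<comment> \<open>The integral for counting measure agrees with \<open>infsum\<close> under
    absolute summability, which for the inner integrals follows from integrability of
    \<open>h\<close> on the product.\<close>
  have "integrable ?C (\<lambda>m. \<integral>x. h m x \<partial>torus_measure)"
    using integrable_fst'[OF \<open>integrable (?C \<Otimes>\<^sub>M torus_measure) (case_prod h)\<close>] by simp
  then have "(\<lambda>m. norm (\<integral>x. h m x \<partial>torus_measure)) summable_on UNIV"
    using abs_summable_equivalent[of "\<lambda>m. \<integral>x. h m x \<partial>torus_measure" UNIV]
    by (simp add: abs_summable_on_def)
  then have "(\<integral>m. (\<integral>x. h m x \<partial>torus_measure) \<partial>?C) = (\<Sum>\<^sub>\<infinity>m. \<integral>x. h m x \<partial>torus_measure)"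
    using infsetsum_infsum[of "\<lambda>m. \<integral>x. h m x \<partial>torus_measure" UNIV]
      abs_summable_equivalent[of "\<lambda>m. \<integral>x. h m x \<partial>torus_measure" UNIV]
    by (simp add: infsetsum_def)
  with swap show ?thesis
    by (simp add: Op_def sum_h int_h)
qed

text \<open>Coordinates are bounded by the norm, so these lattice points lie in a finite integer
  box. This turns decay of \<open>lam\<close> at infinity into finiteness of its superlevel
  sets.\<close>

lemma finite_real_vec_ball: "finite {k :: int ^ 'n. norm (real_vec k) < R}"
proof (rule finite_subset)
  let ?P = "Pi\<^sub>E (UNIV :: 'n set) (\<lambda>_. {- \<lceil>R\<rceil>..\<lceil>R\<rceil>})"
  show "{k :: int ^ 'n. norm (real_vec k) < R} \<subseteq> vec_lambda ` ?P"
  proof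
    fix k :: "int ^ 'n"
    assume "k \<in> {k. norm (real_vec k) < R}"
    then have "\<bar>real_of_int (k $ i)\<bar> < R" for i
      using component_le_norm_cart[of "real_vec k" i] by (simp add: real_vec_def)
    then have "k $ i \<in> {- \<lceil>R\<rceil>..\<lceil>R\<rceil>}" for i
      by (smt (verit) atLeastAtMost_iff le_of_int_ceiling of_int_le_iff of_int_minus)
    then have "vec_nth k \<in> ?P"
      by auto
    then show "k \<in> vec_lambda ` ?P"
      by (metis image_eqI vec_nth_inverse)
  qed
  show "finite (vec_lambda ` ?P :: (int ^ 'n) set)"
    by (intro finite_imageI finite_PiE) auto
qed

text \<open>The first conjunct guarantees that the description \<open>THE\<close> in
  \<open>Op_ell\<close> denotes the extension by density, so that the compactness claim concerns
  that operator.\<close>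

theorem theorem5p13:
  fixes \<sigma> :: "int ^ 'n \<Rightarrow> real ^ 'n \<Rightarrow> complex"
    and lam :: "int ^ 'n \<Rightarrow> real"
    and \<omega> :: "int ^ 'n \<Rightarrow> complex"
    and p :: real
  assumes "\<And>k. torus_function (\<sigma> k)"
    and "(\<lambda>(k, x). \<sigma> k x) \<in> borel_measurable (count_space UNIV \<Otimes>\<^sub>M lebesgue)"
    and "\<And>k. integrable torus_measure (\<sigma> k)"
    and "\<And>k. lam k > 0"
    and "\<omega> \<in> ell 1"
    and "\<And>k m. norm (fourier_symbol \<sigma> k m) \<le> lam k * norm (\<omega> m)"
    and "(lam \<longlongrightarrow> 0) (filtercomap (\<lambda>k. norm (real_vec k)) at_top)"
    and "1 \<le> p"
  shows "(\<exists>!T. density_extension p (Op \<sigma>) T) \<and> compact_operator p (Op_ell p \<sigma>)"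
proof -
  \<comment> \<open>With this shift the hypothesis on the symbol becomes domination by
    \<open>lam k * norm (\<omega> (m - k))\<close>, the form required of the kernel.\<close>
  define K where "K k m = fourier_symbol \<sigma> k (m - k)" for k m
  let ?T = "restrict (kernel_op K) (ell p)"
  have fin: "finite {k. e < lam k}" if e: "0 < e" for e
  proof -
    have "eventually (\<lambda>k. lam k < e) (filtercomap (\<lambda>k. norm (real_vec k)) at_top)"
      using order_tendstoD(2)[OF assms(7) e] .
    then obtain R where R: "\<And>k. R \<le> norm (real_vec k) \<Longrightarrow> lam k < e"
      unfolding eventually_filtercomap eventually_at_top_linorder by blast
    have "{k. e < lam k} \<subseteq> {k. norm (real_vec k) < R}"
      using R by (force simp: not_le[symmetric])
    then show ?thesis
      by (rule finite_subset) (rule finite_real_vec_ball)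
  qed
  have "(\<lambda>m. norm (\<omega> m)) summable_on UNIV"
    using assms(5) by (simp add: mem_ell_1)
  moreover have "norm (K k m) \<le> lam k * norm (\<omega> (m - k))" for k m
    unfolding K_def by (rule assms(6))
  ultimately have bounded: "bounded_operator p ?T" and compact: "compact_operator p ?T"
    using bounded_operator_kernel_op[OF assms(8) norm_ge_zero, where lam = lam]
      compact_operator_kernel_op[OF assms(8) norm_ge_zero, where lam = lam] fin
    by blast+
  have "?T f = Op \<sigma> f" if f: "f \<in> ell 1" for f
    using Op_eq_infsum[OF assms(3) f] ell_1_subset[OF assms(8) f]
    by (simp add: kernel_op_def K_def fun_eq_iff)
  with bounded have T: "density_extension p (Op \<sigma>) ?T"
    unfolding density_extension_def by auto
  then have unique: "T = ?T" if "density_extension p (Op \<sigma>) T" for T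
    using density_extension_unique[OF assms(8) that] by blast
  then have "Op_ell p \<sigma> = ?T"
    unfolding Op_ell_def using T by (intro the_equality)
  moreover have "\<exists>!T. density_extension p (Op \<sigma>) T"
    using T unique by (rule ex1I)
  ultimately show ?thesis
    using compact by simp
qed

end
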